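(* Let $j$ be a non-negative integer. For $|q|<1$, and for either choice of sign (upper signs throughout, or lower signs throughout), \begin{enumerate} \item[(i)] $\displaystyle V^{\pm}_{j}(q) = \frac{(\pm q;q)^2_\infty}{(q;q)^2_\infty} \sum_{k=j}^\infty (\pm 1)^{k-j} B_{k,j} \Big(-1+(1+q^k) \sum_{\ell=k}^\infty (-1)^{\ell-k}\,q^{\ell(\ell+1)/2-k(k+1)/2}\Big)$; \item[(ii)] $\displaystyle W^{\pm}_{j}(q) = \frac{(\pm q;q^2)^2_\infty}{(q^2;q^2)^2_\infty} \sum_{k=j}^\infty (\pm 1)^{k-j} B_{k,j} \sum_{\ell=k}^\infty (-1)^{\ell-k}\,q^{\ell(\ell+1)-k^2}$. \end{enumerate}
   Context: For $n\ge0$, $(a;q)_n=\prod_{r=0}^{n-1}(1-aq^r)$, and $(a;q)_\infty=\lim_{n\to\infty}(a;q)_n$ for $|q|<1$. For a non-negative integer $k$ define $$V^{\pm}_{k}(q)=\sum_{1\le n_1\le n_2\le\cdots\le n_k}\prod_{i=1}^k\frac{q^{n_i}}{(1\mp q^{n_i})^2},\qquad W^{\pm}_{k}(q)=\sum_{1\le n_1\le n_2\le\cdots\le n_k}\prod_{i=1}^k\frac{q^{2n_i-1}}{(1\mp q^{2n_i-1})^2},$$ with $V^{\pm}_0(q)=W^{\pm}_0(q)=1$. The coefficients $B_{k,j}$ (for $k\ge j\ge 0$) are $B_{0,0}=1$, $B_{k,0}=2$ for $k\ge1$, and $B_{k,j}=\frac{2k}{k+j}\binom{k+j}{2j}$ for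 $j\ge1$, $k\ge j$. *)

theory Defs
  imports "HOL-Analysis.Analysis"
begin

definition qpoch :: "complex \<Rightarrow> complex \<Rightarrow> nat \<Rightarrow> complex" where
  "qpoch a q n = (\<Prod>r<n. 1 - a * q ^ r)"

definition qpoch_inf :: "complex \<Rightarrow> complex \<Rightarrow> complex" where
  "qpoch_inf a q = lim (\<lambda>n. qpoch a q n)"

text \<open>The tuples \<open>1 \<le> n\<^sub>1 \<le> n\<^sub>2 \<le> \<dots> \<le> n\<^sub>k\<close>, as lists.\<close>

definition incr_tuples :: "nat \<Rightarrow> nat list set" where
  "incr_tuples k = {ns. length ns = k \<and> sorted ns \<and> (\<forall>n\<in>set ns. 1 \<le> n)}"

text \<open>The sign is the parameter \<open>s\<close>: the functions with superscript \<open>+\<close> and \<open>-\<close> are those for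
  \<open>s = 1\<close> and \<open>s = -1\<close>, so that the denominators \<open>1 \<mp> x\<close> become \<open>1 - s * x\<close>.\<close>

definition V :: "complex \<Rightarrow> nat \<Rightarrow> complex \<Rightarrow> complex" where
  "V s k q = (\<Sum>\<^sub>\<infinity>ns\<in>incr_tuples k. \<Prod>i<k. q ^ (ns ! i) / (1 - s * q ^ (ns ! i))\<^sup>2)"

definition W :: "complex \<Rightarrow> nat \<Rightarrow> complex \<Rightarrow> complex" where
  "W s k q = (\<Sum>\<^sub>\<infinity>ns\<in>incr_tuples k.
     \<Prod>i<k. q ^ (2 * ns ! i - 1) / (1 - s * q ^ (2 * ns ! i - 1))\<^sup>2)"

lemma incr_tuples_0: "incr_tuples 0 = {[]}"
  by (auto simp: incr_tuples_def)

lemma V_0: "V s 0 q = 1" and W_0: "W s 0 q = 1"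
  by (simp_all add: V_def W_def incr_tuples_0)

definition B :: "nat \<Rightarrow> nat \<Rightarrow> real" where
  "B k j = (if j = 0 then (if k = 0 then 1 else 2)
            else 2 * real k / real (k + j) * real ((k + j) choose (2 * j)))"

end

theory Submission imports Defs begin

text \<open>
  Both families are complete homogeneous symmetric functions of nodes
  \<open>y n = p n / (1 - s * p n)\<^sup>2\<close> with \<open>p n = c * Q ^ n\<close>: take \<open>c = Q = q\<close> for \<open>V\<close>, and
  \<open>c = q\<close>, \<open>Q = q\<^sup>2\<close> for \<open>W\<close>. For finitely many nodes, partial fractions give
  \<open>h j = (\<Sum>n. y n ^ j * (\<Prod>m \<noteq> n. y n / (y n - y m)))\<close>. Because \<open>s\<^sup>2 = 1\<close>, each factor equals
  \<open>(1 - s * p m)\<^sup>2 / ((1 - p m / p n) * (1 - p m * p n))\<close>, so the products are q-Pochhammer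
  symbols, and Tannery's theorem lets the number of nodes tend to infinity. Expanding
  \<open>p ^ j * (1 + s * p) / (1 - s * p) ^ (2 * j + 1) = (\<Sum>k\<ge>j. s ^ (k - j) * B k j * p ^ k)\<close>
  and exchanging the two summations yields the claim. The point \<open>q = 0\<close>, where the nodes
  degenerate, is treated directly.
\<close>

section \<open>Complete homogeneous sums\<close>

text \<open>Entries still start at 1, so for \<open>N = 0\<close> only the empty tuple
  remains.\<close>

definition bounded_tuples :: "nat \<Rightarrow> nat \<Rightarrow> nat list set" where
  "bounded_tuples N k = {ns \<in> incr_tuples k. set ns \<subseteq> {..N}}"

text \<open>The complete homogeneous symmetric polynomial of degree \<open>k\<close> in
  \<open>y 1, ..., y N\<close>; \<open>y 0\<close> never enters. The semiring type admits complex
  nodes as well as their real norms.\<close>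

definition complete_hom :: "(nat \<Rightarrow> 'a::comm_semiring_1) \<Rightarrow> nat \<Rightarrow> nat \<Rightarrow> 'a" where
  "complete_hom y N k = (\<Sum>ns\<in>bounded_tuples N k. \<Prod>i<k. y (ns ! i))"

lemma finite_bounded_tuples: "finite (bounded_tuples N k)"
  by (rule finite_subset[OF _ finite_lists_length_eq[of "{..N}" k]])
     (auto simp: bounded_tuples_def incr_tuples_def)

lemma bounded_tuples_subset: "ns \<in> bounded_tuples N k \<Longrightarrow> ns \<in> incr_tuples k"
  by (simp add: bounded_tuples_def)

lemma complete_hom_0_right: "complete_hom y N 0 = 1"
proof -
  have "bounded_tuples N 0 = {[]}"
    by (auto simp: bounded_tuples_def incr_tuples_def)
  thus ?thesis by (simp add: complete_hom_def)
qed

lemma complete_hom_0_Suc: "complete_hom y 0 (Suc k) = 0"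
proof -
  have "ns \<notin> bounded_tuples 0 (Suc k)" for ns
    by (cases ns) (auto simp: bounded_tuples_def incr_tuples_def)
  hence "bounded_tuples 0 (Suc k) = {}" by blast
  thus ?thesis by (simp add: complete_hom_def)
qed

text \<open>In a sorted tuple the maximal value \<open>Suc N\<close>, if present, stands
  last.\<close>

lemma bounded_tuples_Suc_Suc:
  "bounded_tuples (Suc N) (Suc k) =
     bounded_tuples N (Suc k) \<union> (\<lambda>ns. ns @ [Suc N]) ` bounded_tuples (Suc N) k"
proof (intro equalityI subsetI)
  fix ns assume ns: "ns \<in> bounded_tuples (Suc N) (Suc k)"
  then obtain ms n where eq: "ns = ms @ [n]"
    by (cases ns rule: rev_cases) (auto simp: bounded_tuples_def incr_tuples_def)
  show "ns \<in> bounded_tuples N (Suc k) \<union> (\<lambda>ns. ns @ [Suc N]) ` bounded_tuples (Suc N) k"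
    using ns unfolding eq
    by (cases "n = Suc N")
       (force simp: bounded_tuples_def incr_tuples_def sorted_append)+
qed (auto simp: bounded_tuples_def incr_tuples_def sorted_append)

lemma complete_hom_Suc_Suc:
  "complete_hom y (Suc N) (Suc k) = complete_hom y N (Suc k) + y (Suc N) * complete_hom y (Suc N) k"
proof -
  let ?A = "bounded_tuples N (Suc k)" and ?B = "bounded_tuples (Suc N) k"
  have disj: "?A \<inter> (\<lambda>ns. ns @ [Suc N]) ` ?B = {}"
    by (auto simp: bounded_tuples_def)
  have "(\<Sum>ns\<in>(\<lambda>ns. ns @ [Suc N]) ` ?B. \<Prod>i<Suc k. y (ns ! i))
      = (\<Sum>ns\<in>?B. \<Prod>i<Suc k. y ((ns @ [Suc N]) ! i))"
    by (subst sum.reindex) (auto simp: inj_on_def)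
  also have "\<dots> = (\<Sum>ns\<in>?B. y (Suc N) * (\<Prod>i<k. y (ns ! i)))"
    by (intro sum.cong refl)
       (auto simp: bounded_tuples_def incr_tuples_def nth_append mult.commute)
  also have "\<dots> = y (Suc N) * complete_hom y (Suc N) k"
    by (simp add: complete_hom_def sum_distrib_left)
  finally show ?thesis
    unfolding complete_hom_def bounded_tuples_Suc_Suc
    by (subst sum.union_disjoint)
       (use disj in \<open>simp_all add: finite_bounded_tuples complete_hom_def\<close>)
qed

text \<open>Each sorted tuple labels one term of the expanded power. The proof uses the recurrence
  \<open>complete_hom_Suc_Suc\<close> instead of the expansion.\<close>

lemma complete_hom_le_power_sum:
  fixes y :: "nat \<Rightarrow> real"
  assumes "\<And>n. y n \<ge> 0"
  shows "complete_hom y N k \<le> (\<Sum>n=1..N. y n) ^ k"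
proof (induction k arbitrary: N)
  case 0
  show ?case by (simp add: complete_hom_0_right)
next
  case (Suc k)
  show ?case
  proof (induction N)
    case 0
    show ?case by (simp add: complete_hom_0_Suc)
  next
    case (Suc N)
    let ?C = "\<Sum>n=1..N. y n"
    have C: "?C \<ge> 0" "y (Suc N) \<ge> 0" using assms by (auto intro: sum_nonneg)
    have "complete_hom y (Suc N) (Suc k) \<le> ?C ^ Suc k + y (Suc N) * (\<Sum>n=1..Suc N. y n) ^ k"
      unfolding complete_hom_Suc_Suc using Suc.IH \<open>\<And>N. complete_hom y N k \<le> _\<close>[of "Suc N"] C
      by (intro add_mono mult_left_mono) auto
    also have "\<dots> = ?C * ?C ^ k + y (Suc N) * (?C + y (Suc N)) ^ k" by simp
    also have "\<dots> \<le> ?C * (?C + y (Suc N)) ^ k + y (Suc N) * (?C + y (Suc N)) ^ k"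
      using C by (intro add_mono mult_left_mono power_mono order_refl) auto
    also have "\<dots> = (\<Sum>n=1..Suc N. y n) ^ Suc k" by (simp add: algebra_simps)
    finally show ?case .
  qed
qed

lemma finite_subset_bounded_tuples:
  assumes "finite F" "F \<subseteq> incr_tuples k"
  obtains N where "F \<subseteq> bounded_tuples N k"
proof -
  have "finite (\<Union>(set ` F))" using assms by auto
  then obtain N where "\<Union>(set ` F) \<subseteq> {..N}"
    using finite_nat_iff_bounded_le by auto
  with assms that[of N] show ?thesis by (auto simp: bounded_tuples_def)
qed

text \<open>Any finite set of tuples sits inside one truncation, where the norms add up to at most
  the \<open>k\<close>-th power of the full series.\<close>

lemma tuple_products_summable:
  fixes y :: "nat \<Rightarrow> complex"
  assumes "summable (\<lambda>n. norm (y n))"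
  shows "(\<lambda>ns. \<Prod>i<k. y (ns ! i)) summable_on incr_tuples k"
proof (rule abs_summable_summable, rule nonneg_bdd_above_summable_on)
  show "bdd_above (sum (\<lambda>ns. norm (\<Prod>i<k. y (ns ! i))) ` {F. F \<subseteq> incr_tuples k \<and> finite F})"
  proof (rule bdd_aboveI2)
    fix F assume "F \<in> {F. F \<subseteq> incr_tuples k \<and> finite F}"
    then obtain N where N: "F \<subseteq> bounded_tuples N k"
      using finite_subset_bounded_tuples by blast
    have "(\<Sum>ns\<in>F. norm (\<Prod>i<k. y (ns ! i))) \<le> (\<Sum>ns\<in>bounded_tuples N k. norm (\<Prod>i<k. y (ns ! i)))"
      using N by (intro sum_mono2 finite_bounded_tuples) auto
    also have "\<dots> = complete_hom (\<lambda>n. norm (y n)) N k"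
      by (simp add: complete_hom_def prod_norm)
    also have "\<dots> \<le> (\<Sum>n=1..N. norm (y n)) ^ k"
      by (rule complete_hom_le_power_sum) simp
    also have "\<dots> \<le> (\<Sum>n. norm (y n)) ^ k"
      using assms by (intro power_mono sum_le_suminf sum_nonneg) auto
    finally show "(\<Sum>ns\<in>F. norm (\<Prod>i<k. y (ns ! i))) \<le> (\<Sum>n. norm (y n)) ^ k" .
  qed
qed auto

text \<open>The truncations eventually contain every finite set of tuples, so the unordered sum is
  the limit along them.\<close>

lemma complete_hom_tendsto:
  fixes y :: "nat \<Rightarrow> complex"
  assumes "summable (\<lambda>n. norm (y n))"
  shows "(\<lambda>N. complete_hom y N k) \<longlonglongrightarrow> (\<Sum>\<^sub>\<infinity>ns\<in>incr_tuples k. \<Prod>i<k. y (ns ! i))"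
proof -
  have "filterlim (\<lambda>N. bounded_tuples N k) (finite_subsets_at_top (incr_tuples k)) sequentially"
    unfolding filterlim_finite_subsets_at_top
  proof (intro allI impI)
    fix F assume "finite F \<and> F \<subseteq> incr_tuples k"
    then obtain M where "F \<subseteq> bounded_tuples M k"
      using finite_subset_bounded_tuples by blast
    hence "F \<subseteq> bounded_tuples N k" if "N \<ge> M" for N
      using that by (fastforce simp: bounded_tuples_def)
    thus "\<forall>\<^sub>F N in sequentially. finite (bounded_tuples N k) \<and> F \<subseteq> bounded_tuples N k
            \<and> bounded_tuples N k \<subseteq> incr_tuples k"
      unfolding eventually_sequentially
      by (intro exI[of _ M]) (auto simp: finite_bounded_tuples bounded_tuples_subset)
  qed
  from filterlim_compose[OF has_sum_infsum[OF tuple_products_summable[OF assms, of k],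
      unfolded has_sum_def] this]
  show ?thesis by (simp add: complete_hom_def)
qed

section \<open>Partial fractions for finitely many distinct nodes\<close>

text \<open>The coefficient of \<open>1 / (1 - y n * x)\<close> in the partial fraction
  decomposition of the product of \<open>1 / (1 - y m * x)\<close> over \<open>m\<close> in
  \<open>S\<close>.\<close>

definition lagrange :: "('b \<Rightarrow> 'a::field) \<Rightarrow> 'b set \<Rightarrow> 'b \<Rightarrow> 'a" where
  "lagrange y S n = (\<Prod>m\<in>S - {n}. y n / (y n - y m))"

text \<open>Only the factor for \<open>m = a\<close> changes when \<open>a\<close> is deleted; its
  denominator is cleared, so multiplying by \<open>y n - y a\<close> deletes the node.\<close>

lemma lagrange_remove:
  assumes "finite S" "inj_on y S" "a \<in> S" "n \<in> S - {a}"
  shows "lagrange y S n * (y n - y a) = y n * lagrange y (S - {a}) n"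
proof -
  have eq: "S - {n} = insert a (S - {a} - {n})" using assms by auto
  have "y n \<noteq> y a" using assms by (auto simp: inj_on_def)
  moreover have "lagrange y S n = y n / (y n - y a) * lagrange y (S - {a}) n"
    unfolding lagrange_def eq using assms(1) by (subst prod.insert) auto
  ultimately show ?thesis by (simp add: field_simps)
qed

text \<open>With \<open>E = (\<Sum>n\<in>S. lagrange y S n / y n)\<close>, deleting any node \<open>a\<close> gives
  \<open>(\<Sum>n\<in>S. lagrange y S n) - y a * E = 1\<close> by induction; two different choices of \<open>a\<close> force \<open>E = 0\<close>.\<close>

lemma sum_lagrange:
  fixes y :: "'b \<Rightarrow> 'a::field"
  assumes "finite S" "S \<noteq> {}" "inj_on y S" "\<And>n. n \<in> S \<Longrightarrow> y n \<noteq> 0"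
  shows "(\<Sum>n\<in>S. lagrange y S n) = 1"
  using assms
proof (induction "card S" arbitrary: S rule: less_induct)
  case less
  from less.prems obtain a where a: "a \<in> S" by auto
  show ?case
  proof (cases "S = {a}")
    case True
    thus ?thesis by (simp add: lagrange_def)
  next
    case False
    with a obtain b where b: "b \<in> S" "b \<noteq> a" by auto
    define E where "E = (\<Sum>n\<in>S. lagrange y S n / y n)"
    have del: "(\<Sum>n\<in>S. lagrange y S n) - y x * E = 1" if x: "x \<in> S" for x
    proof -
      have "(\<Sum>n\<in>S. lagrange y S n) - y x * E = (\<Sum>n\<in>S. lagrange y S n * (y n - y x) / y n)"
        unfolding E_def sum_distrib_left sum_subtractf[symmetric]
        by (rule sum.cong) (use less.prems in \<open>auto simp: field_simps\<close>)
      also have "\<dots> = (\<Sum>n\<in>S - {x}. lagrange y S n * (y n - y x) / y n)"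
        using less.prems x by (subst sum.remove[of _ x]) auto
      also have "\<dots> = (\<Sum>n\<in>S - {x}. lagrange y (S - {x}) n)"
        by (rule sum.cong) (use less.prems x in \<open>auto simp: lagrange_remove\<close>)
      also have "\<dots> = 1"
      proof (rule less.hyps)
        show "card (S - {x}) < card S" using less.prems x by (intro psubset_card_mono) auto
        show "S - {x} \<noteq> {}" using a b by blast
        show "inj_on y (S - {x})" using less.prems(3) by (rule inj_on_subset) auto
      qed (use less.prems in auto)
      finally show ?thesis .
    qed
    have "y a * E = y b * E" using del[OF a] del[OF b(1)] by (simp add: algebra_simps)
    moreover have "y a \<noteq> y b" using less.prems(3) a b by (auto simp: inj_on_def)
    ultimately have "E = 0" by simp
    with del[OF a] show ?thesis by simp
  qed
qed

text \<open>Tuples have entries \<open>\<ge> 1\<close>, hence the shift of the nodes by one.\<close>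

lemma complete_hom_eq_sum_lagrange:
  fixes y :: "nat \<Rightarrow> 'a::field"
  assumes inj: "inj y" and nz: "\<And>n. y n \<noteq> 0" and "N > 0 \<or> k > 0"
  shows "complete_hom (\<lambda>n. y (n - 1)) N k = (\<Sum>n<N. y n ^ k * lagrange y {..<N} n)"
  using assms(3)
proof (induction k arbitrary: N)
  case 0
  \<comment> \<open>Here \<open>N > 0\<close>: with no nodes this sum is 0, while
    \<open>complete_hom\<close> of degree 0 is 1.\<close>
  have "(\<Sum>n<N. lagrange y {..<N} n) = 1"
    using 0 nz by (intro sum_lagrange inj_on_subset[OF inj]) auto
  thus ?case by (simp add: complete_hom_0_right)
next
  case (Suc k)
  note IH = this
  show ?case
  proof (induction N)
    case 0
    show ?case by (simp add: complete_hom_0_Suc)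
  next
    case (Suc N)
    let ?L = "lagrange y {..<Suc N}"
    have eq: "{..<Suc N} - {N} = {..<N}" by auto
    \<comment> \<open>The factor \<open>y n - y N\<close> removes the last node from every
      coefficient and annihilates the term \<open>n = N\<close>. Hence both sides obey
      \<open>complete_hom_Suc_Suc\<close>.\<close>
    have "(\<Sum>n<Suc N. y n ^ Suc k * ?L n) - y N * (\<Sum>n<Suc N. y n ^ k * ?L n)
        = (\<Sum>n<Suc N. y n ^ k * (?L n * (y n - y N)))"
      by (simp only: sum_distrib_left sum_subtractf[symmetric]) (simp add: algebra_simps)
    also have "\<dots> = (\<Sum>n<N. y n ^ k * (?L n * (y n - y N)))" by simp
    also have "\<dots> = (\<Sum>n<N. y n ^ Suc k * lagrange y {..<N} n)"
    proof (rule sum.cong)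
      fix n assume "n \<in> {..<N}"
      hence "?L n * (y n - y N) = y n * lagrange y {..<N} n"
        using lagrange_remove[of "{..<Suc N}" y N n] inj_on_subset[OF inj] eq by auto
      thus "y n ^ k * (?L n * (y n - y N)) = y n ^ Suc k * lagrange y {..<N} n" by simp
    qed simp
    finally show ?case
      using Suc.IH IH(1)[of "Suc N"] by (simp add: complete_hom_Suc_Suc algebra_simps)
  qed
qed

section \<open>Geometric nodes\<close>

text \<open>No factor vanishes because \<open>norm (a * q ^ r) \<le> norm a < 1\<close>, and a
  geometric series makes the product absolutely convergent, hence its limit nonzero.\<close>

lemma qpoch_tendsto:
  assumes "norm a < 1" "norm q < 1"
  shows "(\<lambda>n. qpoch a q n) \<longlonglongrightarrow> qpoch_inf a q"
    and "qpoch_inf a q \<noteq> 0"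
    and "qpoch a q n \<noteq> 0"
proof -
  let ?f = "\<lambda>r. 1 - a * q ^ r"
  have nz: "?f r \<noteq> 0" for r
  proof
    assume "?f r = 0"
    hence "norm (a * q ^ r) = 1" by simp
    moreover have "norm (a * q ^ r) \<le> norm a * 1"
      unfolding norm_mult norm_power using assms by (intro mult_left_mono power_le_one) auto
    ultimately show False using assms by simp
  qed
  have "summable (\<lambda>r. norm (?f r - 1))"
    using assms by (auto simp: norm_mult norm_power intro: summable_mult summable_geometric)
  hence "convergent_prod ?f"
    by (intro abs_convergent_prod_imp_convergent_prod summable_imp_abs_convergent_prod)
  then obtain L where L: "(\<lambda>n. \<Prod>r\<le>n. ?f r) \<longlonglongrightarrow> L" "L \<noteq> 0"
    using convergent_prod_iff_nz_lim[of ?f] nz by blast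
  \<comment> \<open>The limit above runs over \<open>r \<le> n\<close>, one factor more than
    \<open>qpoch\<close>.\<close>
  have lim: "(\<lambda>n. qpoch a q n) \<longlonglongrightarrow> L"
    using L(1) unfolding qpoch_def
    by (subst filterlim_sequentially_Suc[symmetric]) (simp add: lessThan_Suc_atMost)
  hence "qpoch_inf a q = L" unfolding qpoch_inf_def by (rule limI)
  thus "(\<lambda>n. qpoch a q n) \<longlonglongrightarrow> qpoch_inf a q" "qpoch_inf a q \<noteq> 0"
    using lim L by simp_all
  show "qpoch a q n \<noteq> 0" using nz by (simp add: qpoch_def)
qed

text \<open>Convergence to a nonzero limit bounds the sequence and its inverses; such uniform
  constants supply the majorant for Tannery's theorem.\<close>

lemma qpoch_bounds:
  assumes "norm a < 1" "norm q < 1"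
  obtains M where "M > 0" "\<And>n. norm (qpoch a q n) \<le> M" "\<And>n. norm (inverse (qpoch a q n)) \<le> M"
proof -
  have "Bseq (\<lambda>n. qpoch a q n)" "Bseq (\<lambda>n. inverse (qpoch a q n))"
    using qpoch_tendsto[OF assms] by (auto intro!: convergent_imp_Bseq convergentI tendsto_inverse)
  then obtain M1 M2 where "M1 > 0" "\<And>n. norm (qpoch a q n) \<le> M1"
      "M2 > 0" "\<And>n. norm (inverse (qpoch a q n)) \<le> M2"
    unfolding Bseq_def by blast
  thus ?thesis using that[of "max M1 M2"] by (meson le_max_iff_disj less_max_iff_disj)
qed

lemma qpoch_add: "qpoch a q (m + n) = qpoch a q m * qpoch (a * q ^ m) q n"
  by (induction n) (simp_all add: qpoch_def power_add mult_ac)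

lemma qpoch_Suc: "qpoch a q (Suc n) = qpoch a q n * (1 - a * q ^ n)"
  by (simp add: qpoch_def)

lemma triangle_Suc: "Suc n * (Suc n + 1) div 2 = n * (n + 1) div 2 + Suc n"
  by simp

lemma triangle_ge: "(n::nat) \<le> n * (n + 1) div 2"
  by (induction n) simp_all

text \<open>Pulling \<open>- 1 / q ^ Suc i\<close> out of each factor collects the sign and a
  triangular exponent.\<close>

lemma prod_one_minus_inverse_power:
  fixes q :: complex
  assumes "q \<noteq> 0"
  shows "(\<Prod>i<n. 1 - 1 / q ^ Suc i) = (-1) ^ n * qpoch q q n / q ^ (n * (n + 1) div 2)"
proof (induction n)
  case (Suc n)
  have "(\<Prod>i<Suc n. 1 - 1 / q ^ Suc i)
      = (-1) ^ n * qpoch q q n / q ^ (n * (n + 1) div 2) * (1 - 1 / q ^ Suc n)"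
    by (simp only: prod.lessThan_Suc Suc.IH)
  also have "1 - 1 / q ^ Suc n = - (1 - q * q ^ n) / q ^ Suc n"
    using assms by (simp add: field_simps)
  also have "(-1) ^ n * qpoch q q n / q ^ (n * (n + 1) div 2) * (- (1 - q * q ^ n) / q ^ Suc n)
      = (-1) ^ Suc n * qpoch q q (Suc n) / q ^ (Suc n * (Suc n + 1) div 2)"
    unfolding triangle_Suc power_add qpoch_Suc
    by (simp only: times_divide_times_eq power_Suc[of "-1"] mult_minus_left mult_minus_right
        mult_1_left mult.assoc)
  finally show ?case .
qed (simp add: qpoch_def)

section \<open>Nodes over a geometric progression and their Lagrange coefficients\<close>

locale geometric_nodes =
  fixes c Q s :: complex
  assumes norm_c: "norm c < 1" and norm_Q: "norm Q < 1" and c_nz: "c \<noteq> 0" and Q_nz: "Q \<noteq> 0"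
    and s_sq: "s * s = 1"
begin

definition p :: "nat \<Rightarrow> complex" where "p n = c * Q ^ n"

definition y :: "nat \<Rightarrow> complex" where "y n = p n / (1 - s * p n)\<^sup>2"

lemma norm_s: "norm s = 1"
proof -
  have "norm s * norm s = 1" using s_sq by (metis norm_mult norm_one)
  thus ?thesis by (metis norm_ge_zero abs_of_nonneg real_sqrt_abs2 real_sqrt_one)
qed

lemma p_nz: "p n \<noteq> 0"
  using c_nz Q_nz by (simp add: p_def)

lemma norm_p_le: "norm (p n) \<le> norm c"
  unfolding p_def norm_mult norm_power using norm_Q norm_c
  by (intro mult_left_le power_le_one) auto

lemma norm_p: "norm (p n) < 1"
  using norm_p_le norm_c by (rule le_less_trans)

lemma p_eq_iff: "p m = p n \<longleftrightarrow> m = n"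
proof -
  have "False" if "m < n" "p m = p n" for m n
  proof -
    have "norm Q ^ n < norm Q ^ m"
      using that norm_Q Q_nz by (intro power_strict_decreasing) auto
    moreover have "norm Q ^ n = norm Q ^ m"
      using that c_nz unfolding p_def norm_power[symmetric] by simp
    ultimately show False by simp
  qed
  thus ?thesis by (metis linorder_neqE_nat)
qed

lemma one_minus_sp_nz: "1 - s * p n \<noteq> 0"
proof
  assume "1 - s * p n = 0"
  hence "norm (s * p n) = 1" by simp
  thus False using norm_p[of n] norm_s by (simp add: norm_mult)
qed

lemma norm_one_minus_sp_ge: "norm (1 - s * p n) \<ge> 1 - norm c"
  using norm_triangle_ineq2[of 1 "s * p n"] norm_p_le[of n] norm_s by (simp add: norm_mult)

lemma one_minus_pp_nz: "1 - p m * p n \<noteq> 0"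
proof
  assume "1 - p m * p n = 0"
  hence "norm (p m) * norm (p n) = 1" by (metis norm_mult norm_one right_minus_eq)
  moreover have "norm (p m) * norm (p n) < 1 * 1"
    using norm_p by (intro mult_strict_mono) auto
  ultimately show False by simp
qed

lemma y_nz: "y n \<noteq> 0"
  using p_nz one_minus_sp_nz by (simp add: y_def)

text \<open>\<open>1 / y n = p n + 1 / p n - 2 s\<close>, so differences of these reciprocals factor.\<close>

lemma y_diff:
  "y n - y m = (p n - p m) * (1 - p m * p n) / ((1 - s * p n)\<^sup>2 * (1 - s * p m)\<^sup>2)"
proof -
  have "p n * (1 - s * p m)\<^sup>2 - p m * (1 - s * p n)\<^sup>2 = (p n - p m) * (1 - s * s * (p m * p n))"
    by (simp add: power2_eq_square algebra_simps)
  thus ?thesis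
    unfolding y_def using one_minus_sp_nz[of n] one_minus_sp_nz[of m]
    by (simp add: diff_frac_eq s_sq)
qed

lemma y_inj: "inj y"
proof (rule injI)
  fix m n assume "y m = y n"
  hence "(p n - p m) * (1 - p m * p n) = 0"
    using y_diff[of n m] one_minus_sp_nz[of n] one_minus_sp_nz[of m] by simp
  thus "m = n" using one_minus_pp_nz[of m n] p_eq_iff[of n m] by simp
qed

lemma y_quotient:
  assumes "m \<noteq> n"
  shows "y n / (y n - y m) = (1 - s * p m)\<^sup>2 / ((1 - p m / p n) * (1 - p m * p n))"
proof -
  have "p n - p m = p n * (1 - p m / p n)" using p_nz[of n] by (simp add: field_simps)
  thus ?thesis
    unfolding y_diff unfolding y_def
    using one_minus_sp_nz[of n] p_nz[of n] by simp
qed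

lemma norm_y_le: "norm (y n) \<le> norm (p n) / (1 - norm c)\<^sup>2"
  unfolding y_def norm_divide norm_power using norm_one_minus_sp_ge[of n] norm_c
  by (intro divide_left_mono power_mono) (auto intro!: mult_pos_pos zero_less_power simp: one_minus_sp_nz)

lemma y_summable: "summable (\<lambda>n. norm (y n))"
proof (rule summable_comparison_test)
  show "\<exists>N. \<forall>n\<ge>N. norm (norm (y n)) \<le> norm c * norm Q ^ n / (1 - norm c)\<^sup>2"
    using norm_y_le by (auto simp: p_def norm_mult norm_power)
  show "summable (\<lambda>n. norm c * norm Q ^ n / (1 - norm c)\<^sup>2)"
    using norm_Q by (intro summable_divide summable_mult summable_geometric) auto
qed

lemma norm_cc: "norm (c * c) < 1"
  using mult_strict_mono[OF norm_c norm_c] by (simp add: norm_mult)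

lemma norm_sc: "norm (s * c) < 1"
  using norm_c by (simp add: norm_mult norm_s)

text \<open>A factor of the Lagrange coefficient at node \<open>n\<close> that is independent of the
  number of nodes. For \<open>c * c = Q\<close> it collapses to
  \<open>(-1) ^ n * Q ^ (n * (n + 1) div 2)\<close>.\<close>

definition weight :: "nat \<Rightarrow> complex" where
  "weight n = (-1) ^ n * Q ^ (n * (n + 1) div 2) * qpoch (c * c) Q n / qpoch Q Q n"

text \<open>By \<open>y_quotient\<close>, three products over \<open>m \<noteq> n\<close> are
  needed: two are full products divided by their diagonal factor, the third is split at
  \<open>n\<close>.\<close>

lemma lagrange_y:
  assumes "n < N"
  shows "lagrange y {..<N} n = weight n * (1 - (p n)\<^sup>2) / (1 - s * p n)\<^sup>2 *
    ((qpoch (s * c) Q N)\<^sup>2 / (qpoch Q Q (N - (n + 1)) * qpoch (c * c) Q (n + N)))"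
proof -
  let ?S = "{..<N} - {n}"
  have "(\<Prod>m<N. 1 - s * p m) = (1 - s * p n) * (\<Prod>m\<in>?S. 1 - s * p m)"
    using assms by (subst prod.remove[of _ n]) auto
  hence 1: "(\<Prod>m\<in>?S. 1 - s * p m) = qpoch (s * c) Q N / (1 - s * p n)"
    using one_minus_sp_nz[of n] by (simp add: qpoch_def p_def mult_ac)
  have "(\<Prod>m<N. 1 - p m * p n) = (1 - p n * p n) * (\<Prod>m\<in>?S. 1 - p m * p n)"
    using assms by (subst prod.remove[of _ n]) auto
  moreover have "(\<Prod>m<N. 1 - p m * p n) = qpoch (c * c * Q ^ n) Q N"
    by (simp add: qpoch_def p_def mult_ac)
  \<comment> \<open>\<open>qpoch_add\<close> rewrites the symbol with parameter
    \<open>c * c * Q ^ n\<close> as a quotient of two symbols with parameter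
    \<open>c * c\<close>.\<close>
  ultimately have 2: "(\<Prod>m\<in>?S. 1 - p m * p n)
      = qpoch (c * c) Q (n + N) / (qpoch (c * c) Q n * (1 - (p n)\<^sup>2))"
    using one_minus_pp_nz[of n n] qpoch_tendsto(3)[OF norm_cc norm_Q, of n]
    by (simp add: qpoch_add power2_eq_square)
  \<comment> \<open>Below \<open>n\<close> the ratios \<open>p m / p n\<close> are negative powers
    of \<open>Q\<close>, above \<open>n\<close> positive ones.\<close>
  have split: "?S = {..<n} \<union> {n+1..<N}" using assms by auto
  have "(\<Prod>m\<in>?S. 1 - p m / p n) = (\<Prod>m<n. 1 - p m / p n) * (\<Prod>m\<in>{n+1..<N}. 1 - p m / p n)"
    unfolding split by (rule prod.union_disjoint) auto
  also have "(\<Prod>m<n. 1 - p m / p n) = (\<Prod>i<n. 1 - 1 / Q ^ Suc i)"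
  proof -
    have "(\<Prod>m<n. 1 - p m / p n) = (\<Prod>i<n. 1 - p (n - Suc i) / p n)"
      by (rule prod.nat_diff_reindex[symmetric])
    also have "\<dots> = (\<Prod>i<n. 1 - 1 / Q ^ Suc i)"
    proof (rule prod.cong)
      fix i assume "i \<in> {..<n}"
      hence "Q ^ n = Q ^ (n - Suc i) * Q ^ Suc i" unfolding power_add[symmetric] by simp
      thus "1 - p (n - Suc i) / p n = 1 - 1 / Q ^ Suc i"
        using c_nz Q_nz by (simp add: p_def)
    qed simp
    finally show ?thesis .
  qed
  also have "\<dots> = (-1) ^ n * qpoch Q Q n / Q ^ (n * (n + 1) div 2)"
    using Q_nz by (rule prod_one_minus_inverse_power)
  also have "(\<Prod>m\<in>{n+1..<N}. 1 - p m / p n) = qpoch Q Q (N - (n + 1))"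
  proof -
    have "(\<Prod>m\<in>{n+1..<N}. 1 - p m / p n) = (\<Prod>r<N - (n + 1). 1 - p (r + (n + 1)) / p n)"
      using prod.shift_bounds_nat_ivl[of "\<lambda>m. 1 - p m / p n" 0 "n + 1" "N - (n + 1)"] assms
      by (simp add: lessThan_atLeast0)
    also have "\<dots> = qpoch Q Q (N - (n + 1))"
      unfolding qpoch_def using c_nz Q_nz by (simp add: p_def power_add mult_ac)
    finally show ?thesis .
  qed
  finally have 3: "(\<Prod>m\<in>?S. 1 - p m / p n) =
      (-1) ^ n * qpoch Q Q n / Q ^ (n * (n + 1) div 2) * qpoch Q Q (N - (n + 1))" .
  have "lagrange y {..<N} n = (\<Prod>m\<in>?S. (1 - s * p m)\<^sup>2 / ((1 - p m / p n) * (1 - p m * p n)))"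
    unfolding lagrange_def by (rule prod.cong) (auto intro!: y_quotient)
  also have "\<dots> = (\<Prod>m\<in>?S. 1 - s * p m)\<^sup>2 / ((\<Prod>m\<in>?S. 1 - p m / p n) * (\<Prod>m\<in>?S. 1 - p m * p n))"
    by (simp add: prod_dividef prod.distrib prod_power_distrib)
  also have "\<dots> = weight n * (1 - (p n)\<^sup>2) / (1 - s * p n)\<^sup>2 *
    ((qpoch (s * c) Q N)\<^sup>2 / (qpoch Q Q (N - (n + 1)) * qpoch (c * c) Q (n + N)))"
  proof -
    \<comment> \<open>Here \<open>e\<close> stands for \<open>(-1) ^ n\<close>, which is its own
      inverse and may pass from denominator to numerator.\<close>
    have "(A / d)\<^sup>2 / ((e * P / T * R) * (C2 / (C1 * u))) = e * T * C1 / P * u / d\<^sup>2 * (A\<^sup>2 / (R * C2))"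
      if "e * e = 1" for A d e P T R C1 C2 u :: complex
    proof -
      have "inverse e = e" using that inverse_unique by blast
      thus ?thesis by (simp add: divide_inverse power_mult_distrib power_inverse mult_ac)
    qed
    from this[of "(-1) ^ n"] show ?thesis
      unfolding 1 2 3 weight_def by (simp flip: power_mult_distrib)
  qed
  finally show ?thesis .
qed

end

section \<open>Expansion in the coefficients B\<close>

text \<open>The binomial series with exponent \<open>- (m + 1)\<close> at \<open>- x\<close>, where
  the two alternating signs cancel.\<close>

lemma negative_binomial_series:
  fixes x :: complex
  assumes "norm x < 1"
  shows "(\<lambda>i. of_nat ((i + m) choose m) * x ^ i) sums (1 / (1 - x) ^ Suc m)"
proof -
  have nz: "1 - x \<noteq> 0" using assms by auto
  have "(\<lambda>n. (-1) ^ n * ((of_nat (Suc m) + of_nat n - 1) gchoose n) * (-x) ^ n)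
          sums (1 + (-x)) powr (- of_nat (Suc m))"
    using assms by (intro one_plus_neg_powr_powser) simp
  moreover have "(-1) ^ n * ((of_nat (Suc m) + of_nat n - 1) gchoose n) * (-x) ^ n
      = of_nat ((n + m) choose m) * x ^ n" for n
  proof -
    have "(of_nat (Suc m) + of_nat n - 1 :: complex) = of_nat (n + m)" by simp
    hence "((of_nat (Suc m) + of_nat n - 1 :: complex) gchoose n) = of_nat ((n + m) choose n)"
      by (simp only: binomial_gbinomial)
    moreover have "(n + m) choose n = (n + m) choose m"
      using binomial_symmetric[of n "n + m"] by simp
    ultimately show ?thesis by (simp add: mult.commute mult.left_commute flip: power_mult_distrib)
  qed
  moreover have "(1 + (-x)) powr (- of_nat (Suc m)) = 1 / (1 - x) ^ Suc m"
    using nz by (simp only: powr_minus powr_nat) (simp add: field_simps)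
  ultimately show ?thesis by simp
qed

text \<open>Writing \<open>2 * (i + j) = (i + 2 * j) + i\<close> splits \<open>B\<close> in two, and
  binomial absorption simplifies the second part. For \<open>i = 0\<close> the truncated
  \<open>i - 1\<close> would contribute a spurious 1.\<close>

lemma B_eq_binomials:
  "B (i + j) j = real ((i + 2 * j) choose (2 * j)) +
     (if i = 0 then 0 else real ((i - 1 + 2 * j) choose (2 * j)))"
proof (cases "j = 0 \<or> i = 0")
  case True
  thus ?thesis by (auto simp: B_def simp flip: mult_2)
next
  case False
  have "(i + 2 * j - 2 * j) * ((i + 2 * j) choose (2 * j))
      = (i + 2 * j) * ((i + 2 * j - 1) choose (2 * j))"
    by (rule binomial_absorb_comp)
  moreover have "i + 2 * j - 2 * j = i" "i + 2 * j - 1 = i - 1 + 2 * j" using False by auto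
  ultimately have "i * ((i + 2 * j) choose (2 * j)) = (i + 2 * j) * ((i - 1 + 2 * j) choose (2 * j))"
    by (simp only:)
  hence "real (i * ((i + 2 * j) choose (2 * j)))
      = real ((i + 2 * j) * ((i - 1 + 2 * j) choose (2 * j)))"
    by (simp only:)
  hence eq: "real i * real ((i + 2 * j) choose (2 * j))
      = real (i + 2 * j) * real ((i - 1 + 2 * j) choose (2 * j))"
    by (simp only: of_nat_mult)
  have "B (i + j) j = 2 * real (i + j) / real (i + 2 * j) * real ((i + 2 * j) choose (2 * j))"
  proof -
    have "i + j + j = i + 2 * j" by simp
    thus ?thesis using False unfolding B_def by (simp only: de_Morgan_disj if_False)
  qed
  also have "\<dots> = (real (i + 2 * j) * real ((i + 2 * j) choose (2 * j)) +
      real i * real ((i + 2 * j) choose (2 * j))) / real (i + 2 * j)"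
    by (simp add: algebra_simps)
  also have "\<dots> = real ((i + 2 * j) choose (2 * j)) + real ((i - 1 + 2 * j) choose (2 * j))"
    unfolding eq distrib_left[symmetric] using False by (subst nonzero_mult_div_cancel_left) auto
  finally show ?thesis using False by simp
qed

lemma B_nonneg: "B k j \<ge> 0"
  by (simp add: B_def)

text \<open>Multiplying the negative binomial series by \<open>1 + x\<close> adds a copy shifted by
  one place, matching the two binomials in \<open>B\<close>.\<close>

lemma B_series:
  fixes x :: complex
  assumes "norm x < 1"
  shows "(\<lambda>i. of_real (B (i + j) j) * x ^ i) sums ((1 + x) / (1 - x) ^ (2 * j + 1))"
proof -
  let ?b = "\<lambda>i. of_nat ((i + 2 * j) choose (2 * j)) * x ^ i"
  have b: "?b sums (1 / (1 - x) ^ Suc (2 * j))"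
    using assms by (rule negative_binomial_series)
  have "(\<lambda>i. if i = 0 then 0 else of_nat ((i - 1 + 2 * j) choose (2 * j)) * x ^ i)
      sums (x * (1 / (1 - x) ^ Suc (2 * j)))" (is "?f sums _")
  proof -
    have "(\<lambda>i. ?f (Suc i)) sums (x * (1 / (1 - x) ^ Suc (2 * j)))"
      using sums_mult[OF b, of x] by (simp add: mult_ac)
    thus ?thesis by (subst (asm) sums_Suc_iff) simp
  qed
  from sums_add[OF b this]
  have "(\<lambda>i. ?b i + ?f i) sums (1 / (1 - x) ^ Suc (2 * j) + x * (1 / (1 - x) ^ Suc (2 * j)))" .
  moreover have "?b i + ?f i = of_real (B (i + j) j) * x ^ i" for i
    by (simp add: B_eq_binomials algebra_simps)
  ultimately show ?thesis by (simp add: add_divide_distrib)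
qed

lemma B_summable:
  fixes r :: real
  assumes "0 \<le> r" "r < 1"
  shows "summable (\<lambda>i. B (i + j) j * r ^ i)"
proof -
  have "summable (\<lambda>i. of_real (B (i + j) j) * (of_real r :: complex) ^ i)"
    using assms by (intro sums_summable[OF B_series]) simp
  hence "summable (\<lambda>i. of_real (B (i + j) j * r ^ i) :: complex)" by simp
  thus ?thesis by (simp only: summable_of_real_iff)
qed

section \<open>Infinitely many nodes: limit and exchange of summations\<close>

context geometric_nodes
begin

text \<open>Tannery's theorem applies: the factors depending on \<open>N\<close> converge and stay
  bounded, while \<open>weight\<close> is dominated by a geometric sequence. Both claims share these
  bounds.\<close>

lemma weight_summable: "summable (\<lambda>n. norm (weight n))"
  and weighted_lagrange_sums:
    "(\<lambda>n. y n ^ j * (weight n * (1 - (p n)\<^sup>2) / (1 - s * p n)\<^sup>2 *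
        ((qpoch_inf (s * c) Q)\<^sup>2 / (qpoch_inf Q Q * qpoch_inf (c * c) Q))))
      sums (\<Sum>\<^sub>\<infinity>ns\<in>incr_tuples j. \<Prod>i<j. y (ns ! i - 1))" (is "?t sums ?S")
proof -
  obtain M1 where M1: "M1 > 0" "\<And>n. norm (qpoch (s * c) Q n) \<le> M1"
    using qpoch_bounds[OF norm_sc norm_Q] by metis
  obtain M2 where M2: "M2 > 0" "\<And>n. norm (inverse (qpoch Q Q n)) \<le> M2"
    using qpoch_bounds[OF norm_Q norm_Q] by metis
  obtain M3 where M3: "M3 > 0" "\<And>n. norm (qpoch (c * c) Q n) \<le> M3"
      "\<And>n. norm (inverse (qpoch (c * c) Q n)) \<le> M3"
    using qpoch_bounds[OF norm_cc norm_Q] by metis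
  have w: "norm (weight n) \<le> norm Q ^ n * M3 * M2" for n
  proof -
    have "norm (weight n) = norm Q ^ (n * (n + 1) div 2) * norm (qpoch (c * c) Q n)
        * norm (inverse (qpoch Q Q n))"
      by (simp add: weight_def norm_mult norm_divide norm_power norm_inverse divide_inverse)
    also have "\<dots> \<le> norm Q ^ n * M3 * M2"
      using M2 M3 norm_Q triangle_ge[of n]
      by (intro mult_mono power_decreasing mult_nonneg_nonneg) (auto simp: less_imp_le)
    finally show ?thesis .
  qed
  have sum_Q: "summable (\<lambda>n. norm Q ^ n * M3 * M2)"
    using norm_Q by (intro summable_mult2 summable_geometric) auto
  show "summable (\<lambda>n. norm (weight n))"
    by (rule summable_comparison_test[OF _ sum_Q]) (use w in auto)

  \<comment> \<open>A lower bound for \<open>norm ((1 - s * p n)^2)\<close>, uniform in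
    \<open>n\<close>.\<close>
  define D where "D = (1 - norm c)\<^sup>2"
  have D: "D > 0" using norm_c by (simp add: D_def)
  define t where "t N n = y n ^ j * (weight n * (1 - (p n)\<^sup>2) / (1 - s * p n)\<^sup>2 *
    ((qpoch (s * c) Q N)\<^sup>2 / (qpoch Q Q (N - (n + 1)) * qpoch (c * c) Q (n + N))))" for N n
  have bound: "norm (t N n) \<le> (1 / D) ^ j * ((norm Q ^ n * M3 * M2) * 2 / D * (M1\<^sup>2 * (M2 * M3)))" for N n
  proof -
    have 1: "norm (y n) \<le> 1 / D"
      using norm_y_le[of n] norm_p[of n] D unfolding D_def[symmetric]
      by (meson divide_right_mono less_imp_le order_trans)
    have 2: "norm (1 - (p n)\<^sup>2) \<le> 2"
      using norm_triangle_ineq4[of 1 "(p n)\<^sup>2"] norm_p[of n]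
        power_le_one[of "norm (p n)" 2] by (simp add: norm_power)
    have 3: "D \<le> norm ((1 - s * p n)\<^sup>2)"
      unfolding D_def norm_power using norm_one_minus_sp_ge norm_c by (intro power_mono) auto
    have "norm (t N n) = norm (y n) ^ j * (norm (weight n) * norm (1 - (p n)\<^sup>2) / norm ((1 - s * p n)\<^sup>2) *
        ((norm (qpoch (s * c) Q N))\<^sup>2 * (norm (inverse (qpoch Q Q (N - (n + 1))))
           * norm (inverse (qpoch (c * c) Q (n + N))))))"
      by (simp add: t_def norm_mult norm_divide norm_power norm_inverse divide_inverse)
    also have "\<dots> \<le> (1 / D) ^ j * ((norm Q ^ n * M3 * M2) * 2 / D * (M1\<^sup>2 * (M2 * M3)))"
      using 1 2 3 w[of n] M1 M2 M3 D
      by (intro mult_mono power_mono frac_le mult_nonneg_nonneg) (auto simp: less_imp_le)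
    finally show ?thesis .
  qed
  \<comment> \<open>Extension by 0 gives a fixed index set; for \<open>n \<ge> N\<close> the
    subtraction \<open>N - (n + 1)\<close> in \<open>t\<close> would be truncated.\<close>
  define a where "a n N = (if n < N then t N n else 0)" for n N
  have lim: "(\<lambda>N. a n N) \<longlonglongrightarrow> ?t n" for n
  proof -
    have "(\<lambda>N. qpoch Q Q (N - (n + 1))) \<longlonglongrightarrow> qpoch_inf Q Q"
      by (rule filterlim_compose[OF qpoch_tendsto(1)[OF norm_Q norm_Q]
            filterlim_minus_const_nat_at_top])
    moreover have "(\<lambda>N. qpoch (c * c) Q (n + N)) \<longlonglongrightarrow> qpoch_inf (c * c) Q"
      using LIMSEQ_ignore_initial_segment[OF qpoch_tendsto(1)[OF norm_cc norm_Q], of n]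
      by (simp add: add.commute)
    ultimately have "(\<lambda>N. t N n) \<longlonglongrightarrow> ?t n"
      unfolding t_def using qpoch_tendsto[OF norm_sc norm_Q] qpoch_tendsto(2)[OF norm_Q norm_Q]
        qpoch_tendsto(2)[OF norm_cc norm_Q]
      by (intro tendsto_intros) auto
    moreover have "\<forall>\<^sub>F N in sequentially. t N n = a n N"
      using eventually_gt_at_top[of n] by eventually_elim (simp add: a_def)
    ultimately show ?thesis by (rule Lim_transform_eventually)
  qed
  define M where "M n = (1 / D) ^ j * ((norm Q ^ n * M3 * M2) * 2 / D * (M1\<^sup>2 * (M2 * M3)))" for n
  have "norm (a n N) \<le> M n" for n N
    using order_trans[OF norm_ge_zero bound[of N n]] bound[of N n] by (simp add: a_def M_def)
  hence ev: "\<forall>\<^sub>F (n, N) in sequentially \<times>\<^sub>F sequentially. norm (a n N) \<le> M n"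
    by (intro always_eventually) auto
  have sum_M: "summable M"
    unfolding M_def using norm_Q
    by (intro summable_mult summable_mult2 summable_divide summable_geometric) auto
  have tan: "summable (\<lambda>n. norm (?t n))" "(\<lambda>N. \<Sum>n. a n N) \<longlonglongrightarrow> (\<Sum>n. ?t n)"
    using tannerys_theorem[OF lim ev sum_M sequentially_bot] by blast+
  have fin: "(\<Sum>n. a n N) = complete_hom (\<lambda>n. y (n - 1)) N j" if "N > 0" for N
  proof -
    have "(\<Sum>n. a n N) = (\<Sum>n<N. a n N)"
      by (rule suminf_finite) (auto simp: a_def)
    also have "\<dots> = (\<Sum>n<N. y n ^ j * lagrange y {..<N} n)"
      by (rule sum.cong) (auto simp: a_def t_def lagrange_y)
    also have "\<dots> = complete_hom (\<lambda>n. y (n - 1)) N j"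
      using that by (intro complete_hom_eq_sum_lagrange[symmetric] y_inj y_nz) auto
    finally show ?thesis .
  qed
  have "\<forall>\<^sub>F N in sequentially. (\<Sum>n. a n N) = complete_hom (\<lambda>n. y (n - 1)) N j"
    by (rule eventually_mono[OF eventually_gt_at_top[of 0]]) (rule fin)
  with tan(2) have "(\<lambda>N. complete_hom (\<lambda>n. y (n - 1)) N j) \<longlonglongrightarrow> (\<Sum>n. ?t n)"
    by (rule Lim_transform_eventually)
  moreover have "(\<lambda>N. complete_hom (\<lambda>n. y (n - 1)) N j) \<longlonglongrightarrow> ?S"
  proof (rule complete_hom_tendsto)
    show "summable (\<lambda>n. norm (y (n - 1)))"
      by (subst summable_Suc_iff[symmetric]) (simp add: y_summable)
  qed
  ultimately have "?S = (\<Sum>n. ?t n)" using LIMSEQ_unique by blast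
  thus "?t sums ?S" using tan(1) by (simp add: summable_norm_cancel summable_sums)
qed

text \<open>Each term of the limit series is expanded by \<open>B_series\<close> at
  \<open>s * p n\<close>; then the two sums are exchanged and \<open>k = i + j\<close> is
  substituted.\<close>

lemma tuple_sum_eq_double_series:
  "(\<Sum>\<^sub>\<infinity>ns\<in>incr_tuples j. \<Prod>i<j. y (ns ! i - 1)) =
     (qpoch_inf (s * c) Q)\<^sup>2 / (qpoch_inf Q Q * qpoch_inf (c * c) Q) *
     (\<Sum>\<^sub>\<infinity>k\<in>{j..}. s ^ (k - j) * of_real (B k j) * (\<Sum>\<^sub>\<infinity>n. weight n * p n ^ k))"
proof -
  let ?K = "(qpoch_inf (s * c) Q)\<^sup>2 / (qpoch_inf Q Q * qpoch_inf (c * c) Q)"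
  define F where "F n i = weight n * (s ^ i * of_real (B (i + j) j) * p n ^ (i + j))" for n i
  have K: "y n ^ j * (weight n * (1 - (p n)\<^sup>2) / (1 - s * p n)\<^sup>2 * ?K)
      = ?K * (weight n * (p n ^ j * ((1 + s * p n) / (1 - s * p n) ^ (2 * j + 1))))" for n
  proof -
    \<comment> \<open>Because \<open>s * s = 1\<close>, one factor \<open>1 - s * p n\<close>
      cancels, leaving the odd exponent \<open>2 * j + 1\<close> of \<open>B_series\<close>.\<close>
    have "1 - (p n)\<^sup>2 = (1 - s * p n) * (1 + s * p n)"
      using s_sq by (simp add: power2_eq_square algebra_simps)
    moreover have "(1 - s * p n)\<^sup>2 ^ j * (1 - s * p n)\<^sup>2 = (1 - s * p n) * (1 - s * p n) ^ (2 * j + 1)"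
      by (simp add: power_mult power2_eq_square)
    ultimately have "(1 - (p n)\<^sup>2) / ((1 - s * p n)\<^sup>2 ^ j * (1 - s * p n)\<^sup>2)
        = (1 + s * p n) / (1 - s * p n) ^ (2 * j + 1)"
      using one_minus_sp_nz[of n] by (simp only: nonzero_mult_divide_mult_cancel_left not_False_eq_True)
    moreover have "y n ^ j * (weight n * (1 - (p n)\<^sup>2) / (1 - s * p n)\<^sup>2 * ?K)
        = ?K * (weight n * (p n ^ j * ((1 - (p n)\<^sup>2) / ((1 - s * p n)\<^sup>2 ^ j * (1 - s * p n)\<^sup>2))))"
      by (simp add: y_def power_divide mult_ac)
    ultimately show ?thesis by (simp only:)
  qed
  have inner: "(F n has_sum weight n * (p n ^ j * ((1 + s * p n) / (1 - s * p n) ^ (2 * j + 1)))) UNIV" for n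
  proof -
    have x: "norm (s * p n) < 1" using norm_p by (simp add: norm_mult norm_s)
    have "summable (\<lambda>i. norm (of_real (B (i + j) j) * (s * p n) ^ i))"
      using B_summable[of "norm (p n)" j] norm_p B_nonneg
      by (simp add: norm_mult norm_power norm_s)
    from has_sum_cmult_right[OF norm_summable_imp_has_sum[OF this B_series[OF x]], of "weight n * p n ^ j"]
    show ?thesis unfolding F_def[abs_def]
      by (simp add: power_mult_distrib power_add mult_ac)
  qed
  have absF: "(\<lambda>(n, i). F n i) summable_on UNIV \<times> UNIV"
  proof (rule abs_summable_summable, rule Infinite_Sum.abs_summable_on_comparison_test')
    \<comment> \<open>As \<open>norm (p n) \<le> norm c\<close>, the majorant
      \<open>norm (weight n) * b i\<close> separates the two indices.\<close>
    define b where "b i = B (i + j) j * norm c ^ i" for i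
    have b: "b summable_on UNIV" "\<And>i. b i \<ge> 0"
      using B_summable[of "norm c" j] norm_c B_nonneg
      by (auto simp: b_def[abs_def] intro!: summable_nonneg_imp_summable_on)
    have w: "(\<lambda>n. norm (weight n)) summable_on UNIV"
      using weight_summable by (auto intro!: summable_nonneg_imp_summable_on)
    show "(\<lambda>(n, i). norm (weight n) * b i) summable_on UNIV \<times> UNIV"
      by (rule abs_summable_summable, subst Infinite_Sum.abs_summable_on_Sigma_iff)
         (use b w in \<open>auto simp: norm_mult infsum_cmult_right abs_mult
            intro!: summable_on_cmult_right summable_on_cmult_left\<close>)
    fix x :: "nat \<times> nat"
    obtain n i where x: "x = (n, i)" by fastforce
    have "norm (p n) ^ (i + j) \<le> norm (p n) ^ i"
      using norm_p by (intro power_decreasing) (auto simp: less_imp_le)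
    also have "\<dots> \<le> norm c ^ i" by (intro power_mono norm_p_le) auto
    finally show "norm (case x of (n, i) \<Rightarrow> F n i) \<le> (case x of (n, i) \<Rightarrow> norm (weight n) * b i)"
      using b(2)[of i] B_nonneg[of "i + j" j]
      by (auto simp: x F_def b_def norm_mult norm_power norm_s intro!: mult_left_mono)
  qed
  have swap: "(\<Sum>\<^sub>\<infinity>n. \<Sum>\<^sub>\<infinity>i. F n i) = (\<Sum>\<^sub>\<infinity>i. \<Sum>\<^sub>\<infinity>n. F n i)"
    using absF by (rule infsum_swap_banach)
  have "(\<lambda>n. infsum (F n) UNIV) summable_on UNIV"
    using summable_on_Sigma_banach[OF absF] by simp
  hence "(\<lambda>n. infsum (F n) UNIV) sums (\<Sum>\<^sub>\<infinity>n. \<Sum>\<^sub>\<infinity>i. F n i)"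
    by (intro has_sum_imp_sums has_sum_infsum)
  hence "(\<lambda>n. ?K * infsum (F n) UNIV) sums (?K * (\<Sum>\<^sub>\<infinity>n. \<Sum>\<^sub>\<infinity>i. F n i))"
    by (rule sums_mult)
  moreover have "(\<lambda>n. ?K * infsum (F n) UNIV) sums (\<Sum>\<^sub>\<infinity>ns\<in>incr_tuples j. \<Prod>i<j. y (ns ! i - 1))"
    using weighted_lagrange_sums[of j] unfolding K infsumI[OF inner] .
  ultimately have "(\<Sum>\<^sub>\<infinity>ns\<in>incr_tuples j. \<Prod>i<j. y (ns ! i - 1)) = ?K * (\<Sum>\<^sub>\<infinity>n. \<Sum>\<^sub>\<infinity>i. F n i)"
    using sums_unique2 by blast
  also note swap
  also have "(\<Sum>\<^sub>\<infinity>i. \<Sum>\<^sub>\<infinity>n. F n i)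
      = (\<Sum>\<^sub>\<infinity>i. s ^ i * of_real (B (i + j) j) * (\<Sum>\<^sub>\<infinity>n. weight n * p n ^ (i + j)))"
    unfolding infsum_cmult_right'[symmetric] F_def by (simp add: mult_ac)
  also have "\<dots> = (\<Sum>\<^sub>\<infinity>k\<in>{j..}. s ^ (k - j) * of_real (B k j) * (\<Sum>\<^sub>\<infinity>n. weight n * p n ^ k))"
    by (rule infsum_reindex_bij_witness[of _ "\<lambda>k. k - j" "\<lambda>i. i + j"]) auto
  finally show ?thesis .
qed

end

section \<open>Partial theta series\<close>

lemma triangle_add:
  "(n + k) * (n + k + 1) div 2 = n * (n + 1) div 2 + n * k + k * (k + 1) div (2 :: nat)"
proof -
  have "even (n * (n + 1))" "even (k * (k + 1))" by simp_all
  then obtain a b where ab: "n * (n + 1) = 2 * a" "k * (k + 1) = 2 * b"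
    unfolding dvd_def by blast
  have "(n + k) * (n + k + 1) = n * (n + 1) + k * (k + 1) + 2 * (n * k)"
    by (simp add: algebra_simps)
  also have "\<dots> = 2 * (a + n * k + b)" unfolding ab by simp
  finally show ?thesis unfolding ab by simp
qed

lemma partial_theta_summable:
  fixes q :: complex
  assumes "norm q < 1"
  shows "summable (\<lambda>n. norm ((-1) ^ n * q ^ (n * (n + 1) div 2 + n * k)))"
proof (rule summable_comparison_test)
  have "norm q ^ (n * (n + 1) div 2 + n * k) \<le> norm q ^ n" for n
    using assms triangle_ge[of n] by (intro power_decreasing trans_le_add1) auto
  thus "\<exists>N. \<forall>n\<ge>N. norm (norm ((-1) ^ n * q ^ (n * (n + 1) div 2 + n * k))) \<le> norm q ^ n"
    by (auto simp: norm_mult norm_power)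
  show "summable (\<lambda>n. norm q ^ n)" using assms by (intro summable_geometric) auto
qed

text \<open>With \<open>l = n + k\<close>, \<open>triangle_add\<close> shows that the natural
  subtraction in the exponent is exact.\<close>

lemma partial_theta_reindex:
  fixes q :: complex
  shows "(\<Sum>\<^sub>\<infinity>l\<in>{k..}. (- 1) ^ (l - k) * q ^ (l * (l + 1) div 2 - k * (k + 1) div 2))
       = (\<Sum>\<^sub>\<infinity>n. (-1) ^ n * q ^ (n * (n + 1) div 2 + n * k))"
proof (rule infsum_reindex_bij_witness[of _ "\<lambda>n. n + k" "\<lambda>l. l - k"])
  fix l assume "l \<in> {k..}"
  then obtain n where l: "l = n + k" by (metis atLeast_iff le_add_diff_inverse2)
  show "(-1) ^ (l - k) * q ^ ((l - k) * ((l - k) + 1) div 2 + (l - k) * k)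
      = (- 1) ^ (l - k) * q ^ (l * (l + 1) div 2 - k * (k + 1) div 2)"
    unfolding l triangle_add by simp
qed auto

text \<open>With \<open>l = n + k\<close>, the exponent splits off \<open>(2 * n + 1) * k\<close>,
  which is the \<open>k\<close>-th power of \<open>p n = q ^ (2 * n + 1)\<close>.\<close>

lemma square_theta_reindex:
  fixes q :: complex
  shows "(\<Sum>\<^sub>\<infinity>l\<in>{k..}. (- 1) ^ (l - k) * q ^ (l * (l + 1) - k\<^sup>2))
       = (\<Sum>\<^sub>\<infinity>n. (-1) ^ n * q ^ (n * (n + 1) + (2 * n + 1) * k))"
proof (rule infsum_reindex_bij_witness[of _ "\<lambda>n. n + k" "\<lambda>l. l - k"])
  fix l assume "l \<in> {k..}"
  then obtain n where l: "l = n + k" by (metis atLeast_iff le_add_diff_inverse2)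
  have "(n + k) * (n + k + 1) = n * (n + 1) + (2 * n + 1) * k + k\<^sup>2"
    by (simp add: power2_eq_square algebra_simps)
  thus "(-1) ^ (l - k) * q ^ ((l - k) * ((l - k) + 1) + (2 * (l - k) + 1) * k)
      = (- 1) ^ (l - k) * q ^ (l * (l + 1) - k\<^sup>2)"
    unfolding l by (simp only: add_diff_cancel_right')
qed auto

text \<open>Shifting the index by one turns the terms with \<open>- q ^ Suc n\<close> into the same partial theta
  series without its leading term 1.\<close>

lemma partial_theta_fold:
  fixes q :: complex
  assumes "norm q < 1"
  defines "A \<equiv> \<lambda>k. \<Sum>\<^sub>\<infinity>n. (-1) ^ n * q ^ (n * (n + 1) div 2 + n * k)"
  shows "(\<Sum>\<^sub>\<infinity>n. (-1) ^ n * q ^ (n * (n + 1) div 2) * (1 - q ^ Suc n) * (q ^ Suc n) ^ k)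
       = - 1 + (1 + q ^ k) * A k"
proof (rule infsumI)
  define f where "f n = (-1) ^ n * q ^ (n * (n + 1) div 2 + n * k)" for n
  have sm: "summable (\<lambda>n. norm (f n))"
    unfolding f_def using assms(1) by (rule partial_theta_summable)
  have A: "(f has_sum A k) UNIV"
    unfolding A_def f_def[symmetric] using norm_summable_imp_summable_on[OF sm] by simp
  have "(\<lambda>n. f (Suc n)) sums (A k - f 0)"
    using has_sum_imp_sums[OF A] by (subst sums_Suc_iff) simp
  moreover have "summable (\<lambda>n. norm (f (Suc n)))" using sm by (subst summable_Suc_iff)
  ultimately have "((\<lambda>n. f (Suc n)) has_sum (A k - f 0)) UNIV"
    by (intro norm_summable_imp_has_sum)
  hence "((\<lambda>n. q ^ k * f n + f (Suc n)) has_sum (q ^ k * A k + (A k - f 0))) UNIV"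
    by (intro has_sum_add has_sum_cmult_right A)
  moreover have "q ^ k * A k + (A k - f 0) = - 1 + (1 + q ^ k) * A k"
    by (simp add: f_def algebra_simps)
  moreover have "q ^ k * f n + f (Suc n)
      = (-1) ^ n * q ^ (n * (n + 1) div 2) * (1 - q ^ Suc n) * (q ^ Suc n) ^ k" for n
  proof -
    have "(q ^ Suc n) ^ k = q ^ k * q ^ (n * k)"
      by (simp add: power_mult_distrib power_mult)
    moreover have "f (Suc n) = - ((-1) ^ n * (q ^ (n * (n + 1) div 2) * q ^ Suc n * (q ^ k * q ^ (n * k))))"
      unfolding f_def triangle_Suc by (simp add: power_add)
    moreover have "f n = (-1) ^ n * (q ^ (n * (n + 1) div 2) * q ^ (n * k))"
      unfolding f_def by (simp add: power_add)
    moreover have "a * (e * (t * b)) + - (e * (t * u * (a * b))) = e * t * (1 - u) * (a * b)"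
      for a b e t u :: complex
      by (simp add: algebra_simps)
    ultimately show ?thesis by (simp only:)
  qed
  ultimately show "((\<lambda>n. (-1) ^ n * q ^ (n * (n + 1) div 2) * (1 - q ^ Suc n) * (q ^ Suc n) ^ k)
      has_sum - 1 + (1 + q ^ k) * A k) UNIV"
    by simp
qed

section \<open>Specialization to \<open>V\<close> and \<open>W\<close>\<close>

text \<open>Both sides are \<open>qpoch q q (Suc n)\<close>, with the first factor split off on the
  left and the last on the right.\<close>

lemma qpoch_shift: "(1 - q) * qpoch (q * q) q n = qpoch q q n * (1 - q ^ Suc n)"
  using qpoch_add[of q q 1 n] qpoch_Suc[of q q n] by (simp add: qpoch_def)

text \<open>For \<open>c = Q = q\<close>, \<open>qpoch_shift\<close> leaves the factor
  \<open>(1 - q ^ Suc n) / (1 - q)\<close> in \<open>weight n\<close>, and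
  \<open>partial_theta_fold\<close> evaluates the sum over \<open>n\<close>.\<close>

lemma V_formula:
  assumes "norm q < 1" "q \<noteq> 0" "s * s = 1"
  shows "V s j q = (qpoch_inf (s * q) q)\<^sup>2 / (qpoch_inf q q)\<^sup>2 *
    (\<Sum>\<^sub>\<infinity>k\<in>{j..}. s ^ (k - j) * of_real (B k j) *
      (- 1 + (1 + q ^ k) * (\<Sum>\<^sub>\<infinity>n. (-1) ^ n * q ^ (n * (n + 1) div 2 + n * k))))"
proof -
  interpret geometric_nodes q q s by unfold_locales fact+
  have q1: "1 - q \<noteq> 0" using assms by auto
  have inner: "(\<Sum>\<^sub>\<infinity>n. weight n * p n ^ k) = (1 / (1 - q)) *
      (- 1 + (1 + q ^ k) * (\<Sum>\<^sub>\<infinity>n. (-1) ^ n * q ^ (n * (n + 1) div 2 + n * k)))" for k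
  proof -
    have "weight n * p n ^ k = (1 / (1 - q)) *
        ((-1) ^ n * q ^ (n * (n + 1) div 2) * (1 - q ^ Suc n) * (q ^ Suc n) ^ k)" for n
    proof -
      have "qpoch (q * q) q n = qpoch q q n * (1 - q ^ Suc n) / (1 - q)"
        unfolding qpoch_shift[symmetric] using q1 by simp
      hence "weight n = (-1) ^ n * q ^ (n * (n + 1) div 2) * (1 - q ^ Suc n) / (1 - q)"
        unfolding weight_def using qpoch_tendsto(3)[OF norm_Q norm_Q, of n] by simp
      thus ?thesis by (simp add: p_def)
    qed
    thus ?thesis
      unfolding partial_theta_fold[OF assms(1), symmetric] by (simp only: infsum_cmult_right')
  qed
  have "V s j q = (\<Sum>\<^sub>\<infinity>ns\<in>incr_tuples j. \<Prod>i<j. y (ns ! i - 1))"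
    unfolding V_def
  proof (intro infsum_cong prod.cong refl)
    fix ns i assume "ns \<in> incr_tuples j" "i \<in> {..<j}"
    hence "ns ! i \<ge> 1" by (auto simp: incr_tuples_def)
    hence "p (ns ! i - 1) = q ^ (ns ! i)" by (simp add: p_def flip: power_Suc)
    thus "q ^ (ns ! i) / (1 - s * q ^ (ns ! i))\<^sup>2 = y (ns ! i - 1)" by (simp add: y_def)
  qed
  also note tuple_sum_eq_double_series
  \<comment> \<open>The \<open>1 - q\<close> arising here cancels the one stemming from
    \<open>weight\<close>.\<close>
  also have "qpoch_inf (q * q) q = qpoch_inf q q / (1 - q)"
  proof (rule LIMSEQ_unique)
    show "(\<lambda>n. qpoch (q * q) q n) \<longlonglongrightarrow> qpoch_inf (q * q) q"
      by (rule qpoch_tendsto(1)[OF norm_cc norm_Q])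
    have "(\<lambda>n. q ^ Suc n) \<longlonglongrightarrow> 0"
      using LIMSEQ_power_zero[OF norm_Q] by (rule LIMSEQ_Suc)
    hence "(\<lambda>n. qpoch q q n * (1 - q ^ Suc n) / (1 - q)) \<longlonglongrightarrow> qpoch_inf q q * (1 - 0) / (1 - q)"
      using q1 by (intro tendsto_intros qpoch_tendsto(1)[OF norm_Q norm_Q])
    moreover have "qpoch q q n * (1 - q ^ Suc n) / (1 - q) = qpoch (q * q) q n" for n
      unfolding qpoch_shift[symmetric] using q1 by simp
    ultimately show "(\<lambda>n. qpoch (q * q) q n) \<longlonglongrightarrow> qpoch_inf q q / (1 - q)" by simp
  qed
  also have "(\<Sum>\<^sub>\<infinity>k\<in>{j..}. s ^ (k - j) * of_real (B k j) * (\<Sum>\<^sub>\<infinity>n. weight n * p n ^ k))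
    = 1 / (1 - q) * (\<Sum>\<^sub>\<infinity>k\<in>{j..}. s ^ (k - j) * of_real (B k j) *
      (- 1 + (1 + q ^ k) * (\<Sum>\<^sub>\<infinity>n. (-1) ^ n * q ^ (n * (n + 1) div 2 + n * k))))"
    unfolding inner infsum_cmult_right'[symmetric] by (simp only: mult_ac)
  finally show ?thesis using q1 by (simp add: power2_eq_square)
qed

text \<open>For \<open>c = q\<close> and \<open>Q = q^2\<close> one has \<open>c * c = Q\<close>, so
  the symbols in \<open>weight\<close> cancel and the two infinite products in the denominator
  coincide.\<close>

lemma W_formula:
  assumes "norm q < 1" "q \<noteq> 0" "s * s = 1"
  shows "W s j q = (qpoch_inf (s * q) (q\<^sup>2))\<^sup>2 / (qpoch_inf (q\<^sup>2) (q\<^sup>2))\<^sup>2 *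
    (\<Sum>\<^sub>\<infinity>k\<in>{j..}. s ^ (k - j) * of_real (B k j) *
      (\<Sum>\<^sub>\<infinity>n. (-1) ^ n * q ^ (n * (n + 1) + (2 * n + 1) * k)))"
proof -
  have norm_q2: "norm (q\<^sup>2) < 1"
    using assms(1) by (simp add: norm_power power_less_one_iff)
  interpret geometric_nodes q "q\<^sup>2" s
    by unfold_locales (use assms norm_q2 in auto)
  have p: "p n = q ^ (2 * n + 1)" for n
    by (simp add: p_def power_mult)
  have inner: "weight n * p n ^ k = (-1) ^ n * q ^ (n * (n + 1) + (2 * n + 1) * k)" for n k
  proof -
    have "even (n * (n + 1))" by simp
    hence "(q\<^sup>2) ^ (n * (n + 1) div 2) = q ^ (n * (n + 1))"
      by (simp only: power_mult[symmetric] dvd_mult_div_cancel)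
    hence "weight n = (-1) ^ n * q ^ (n * (n + 1))"
      unfolding weight_def power2_eq_square[of q, symmetric]
      using qpoch_tendsto(3)[OF norm_Q norm_Q, of n] by simp
    thus ?thesis by (simp only: p power_add[of q "n * (n + 1)"] power_mult mult.assoc)
  qed
  have "W s j q = (\<Sum>\<^sub>\<infinity>ns\<in>incr_tuples j. \<Prod>i<j. y (ns ! i - 1))"
    unfolding W_def
  proof (intro infsum_cong prod.cong refl)
    fix ns i assume "ns \<in> incr_tuples j" "i \<in> {..<j}"
    hence "ns ! i \<ge> 1" by (auto simp: incr_tuples_def)
    hence "2 * (ns ! i - 1) + 1 = 2 * ns ! i - 1" by simp
    thus "q ^ (2 * ns ! i - 1) / (1 - s * q ^ (2 * ns ! i - 1))\<^sup>2 = y (ns ! i - 1)"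
      by (simp only: y_def p)
  qed
  also note tuple_sum_eq_double_series
  also have "(\<Sum>\<^sub>\<infinity>k\<in>{j..}. s ^ (k - j) * of_real (B k j) * (\<Sum>\<^sub>\<infinity>n. weight n * p n ^ k))
    = (\<Sum>\<^sub>\<infinity>k\<in>{j..}. s ^ (k - j) * of_real (B k j) *
        (\<Sum>\<^sub>\<infinity>n. (-1) ^ n * q ^ (n * (n + 1) + (2 * n + 1) * k)))"
    by (simp only: inner)
  finally show ?thesis by (simp only: power2_eq_square)
qed

section \<open>The degenerate point \<open>q = 0\<close>\<close>

text \<open>As \<open>0 ^ 0 = 1\<close>, only the index 0 survives, and it lies in
  \<open>{j..}\<close> only for \<open>j = 0\<close>.\<close>

lemma infsum_zero_power:
  "(\<Sum>\<^sub>\<infinity>k\<in>{j..}. f k * 0 ^ k) = (if j = 0 then f 0 else (0 :: complex))"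
proof -
  have "(\<Sum>\<^sub>\<infinity>k\<in>{j..}. f k * 0 ^ k) = (\<Sum>\<^sub>\<infinity>k\<in>{j..} \<inter> {0}. f k * 0 ^ k)"
    by (rule infsum_cong_neutral) auto
  thus ?thesis by auto
qed

lemma infsum_alternating_zero_power:
  assumes "\<And>n. n > 0 \<Longrightarrow> e n > 0"
  shows "(\<Sum>\<^sub>\<infinity>n. (-1) ^ n * 0 ^ e n) = (0 :: complex) ^ e 0"
proof -
  have "(\<Sum>\<^sub>\<infinity>n. (-1) ^ n * 0 ^ e n) = (\<Sum>\<^sub>\<infinity>n\<in>{0}. (-1) ^ n * (0 :: complex) ^ e n)"
    by (rule infsum_cong_neutral) (use assms in auto)
  thus ?thesis by simp
qed

lemma qpoch_inf_0: "qpoch_inf 0 q = 1"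
  by (simp add: qpoch_inf_def qpoch_def)

lemma tuple_sum_zero:
  assumes "\<And>n. n \<ge> 1 \<Longrightarrow> y n = (0 :: complex)"
  shows "(\<Sum>\<^sub>\<infinity>ns\<in>incr_tuples j. \<Prod>i<j. y (ns ! i)) = (if j = 0 then 1 else 0)"
proof (cases "j = 0")
  case False
  have "(\<Sum>\<^sub>\<infinity>ns\<in>incr_tuples j. \<Prod>i<j. y (ns ! i)) = (\<Sum>\<^sub>\<infinity>ns\<in>incr_tuples j. 0)"
  proof (rule infsum_cong)
    fix ns assume "ns \<in> incr_tuples j"
    hence "y (ns ! 0) = 0" using False by (auto simp: incr_tuples_def intro!: assms)
    thus "(\<Prod>i<j. y (ns ! i)) = 0" using False by auto
  qed
  thus ?thesis using False by simp
qed (simp add: incr_tuples_0)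

theorem theorem4:
  fixes j :: nat and q s :: complex
  assumes "norm q < 1" and "s = 1 \<or> s = -1"
  shows "V s j q =
           (qpoch_inf (s * q) q)\<^sup>2 / (qpoch_inf q q)\<^sup>2 *
           (\<Sum>\<^sub>\<infinity>k\<in>{j..}. s ^ (k - j) * of_real (B k j) *
              (- 1 + (1 + q ^ k) *
                 (\<Sum>\<^sub>\<infinity>l\<in>{k..}. (- 1) ^ (l - k) * q ^ (l * (l + 1) div 2 - k * (k + 1) div 2))))
         \<and> W s j q =
           (qpoch_inf (s * q) (q\<^sup>2))\<^sup>2 / (qpoch_inf (q\<^sup>2) (q\<^sup>2))\<^sup>2 *
           (\<Sum>\<^sub>\<infinity>k\<in>{j..}. s ^ (k - j) * of_real (B k j) *
              (\<Sum>\<^sub>\<infinity>l\<in>{k..}. (- 1) ^ (l - k) * q ^ (l * (l + 1) - k\<^sup>2)))"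
proof (cases "q = 0")
  case False
  have "s * s = 1" using assms(2) by auto
  with False assms(1) show ?thesis
    unfolding partial_theta_reindex square_theta_reindex using V_formula W_formula by blast
next
  case True
  have V: "V s j 0 = (if j = 0 then 1 else 0)"
    unfolding V_def by (rule tuple_sum_zero) auto
  have W: "W s j 0 = (if j = 0 then 1 else 0)"
    unfolding W_def by (rule tuple_sum_zero) auto
  \<comment> \<open>Only \<open>n = 0\<close> has exponent 0, and its term is 1. The bracket in the
    formula for \<open>V\<close> thus becomes \<open>0 ^ k\<close>, like the inner sum for
    \<open>W\<close> below.\<close>
  have A: "(\<Sum>\<^sub>\<infinity>n. (-1) ^ n * (0 :: complex) ^ (n * (n + 1) div 2 + n * k)) = 1" for k
    using triangle_ge by (subst infsum_alternating_zero_power) (auto intro: less_le_trans trans_le_add1)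
  have C: "(\<Sum>\<^sub>\<infinity>n. (-1) ^ n * (0 :: complex) ^ (n * (n + 1) + (2 * n + 1) * k)) = 0 ^ k" for k
    by (subst infsum_alternating_zero_power) auto
  show ?thesis
    unfolding partial_theta_reindex square_theta_reindex True A C
    by (simp add: V W qpoch_inf_0 infsum_zero_power B_def)
qed

end
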